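(* Define polynomials $b(m,n)$ in $q$, for integers $m,n$, by $b(0,0)=1$, $b(m,n)=0$ if $m<0$ or $n<0$, and, for all $m,n\ge 0$ with $(m,n)\neq(0,0)$, $$b(m,n)=\left(1+q+q^2+\cdots+q^{2m+n-2}\right)b(m-1,n)+q^m\,b(m,n-1).$$ Then for all integers $m,n\ge0$, $$\lim_{q\to1}b(m,n)=\frac{(2m+n)!}{m!\,n!\,2^m}.$$ That is, $\lim_{q\to1}b(m,n)$ is the coefficient of $x^m$ in the Bessel polynomial $y_{m+n}(x)$.
   Context: The Bessel polynomials are $y_N(x)=\sum_{k=0}^{N}\frac{(N+k)!}{(N-k)!\,k!}\left(\frac{x}{2}\right)^k$ for $N\ge0$. In the recurrence, a term in which $b$ has a negative argument is read as $0$ (so the factor $1+q+\cdots+q^{2m+n-2}$ only matters when $m\ge1$, in which case $2m+n-2\ge0$). *)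

theory Defs
  imports Complex_Main "HOL-Computational_Algebra.Polynomial"
begin

(* b m n is a polynomial in q, so monom 1 k stands for q^k. The interval {0..2*m+n-2} of
   integers is empty for m = 0, n = 1, where it multiplies b (-1) 1 = 0. *)
function b :: "int \<Rightarrow> int \<Rightarrow> real poly" where
  "b m n =
     (if m < 0 \<or> n < 0 then 0
      else if m = 0 \<and> n = 0 then 1
      else (\<Sum>k = 0..2 * m + n - 2. monom 1 (nat k)) * b (m - 1) n
           + monom 1 (nat m) * b m (n - 1))"
  by pat_completeness auto
termination
  by (relation "measure (\<lambda>(m, n). nat (m + 1) + nat (n + 1))") auto

declare b.simps [simp del]

definition bessel_poly :: "nat \<Rightarrow> real poly" where
  "bessel_poly N = (\<Sum>k = 0..N. smult (fact (N + k) / (fact (N - k) * fact k)) ([:0, 1 / 2:] ^ k))"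

end

theory Submission
  imports Defs
begin

text \<open>
  A polynomial is continuous, so the limit at \<open>1\<close> is the value at \<open>1\<close>. There the factor
  \<open>1 + q + \<dots> + q^(2m+n-2)\<close> becomes the number \<open>2m+n-1\<close> of its terms and \<open>q^m\<close> becomes \<open>1\<close>, so
  that the values \<open>B(m,n)\<close> satisfy \<open>B(m,n) = (2m+n-1) B(m-1,n) + B(m,n-1)\<close>.
  The closed form \<open>F(m,n) = (2m+n)! / (m! n! 2^m)\<close> satisfies the same recurrence: both
  \<open>(2m+n-1) F(m-1,n)\<close> and \<open>F(m,n-1)\<close> are multiples of \<open>(2m+n-1)! / (m! n! 2^m)\<close>, by
  \<open>2m\<close> and by \<open>n\<close> respectively, and these two multipliers add up to \<open>2m+n\<close>. In the Bessel
  polynomial of degree \<open>m+n\<close> only the summand \<open>k = m\<close> contributes to \<open>x^m\<close>, and its coefficient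
  is \<open>F(m,n)\<close> because \<open>(m+n)+m = 2m+n\<close> and \<open>(m+n)-m = n\<close>.
\<close>

lemma b_neg_left: "m < 0 \<Longrightarrow> b m n = 0"
  by (simp add: b.simps)

lemma b_neg_right: "n < 0 \<Longrightarrow> b m n = 0"
  by (simp add: b.simps)

lemma b_0_0: "b 0 0 = 1"
  by (simp add: b.simps)

lemma poly_b_1_rec:
  assumes "m \<ge> 0" "n \<ge> 0" "m \<noteq> 0 \<or> n \<noteq> 0"
  shows "poly (b m n) 1 = of_int (2 * m + n - 1) * poly (b (m - 1) n) 1 + poly (b m (n - 1)) 1"
proof -
  have "poly (\<Sum>k = 0..2 * m + n - 2. monom 1 (nat k)) (1::real) = of_int (2 * m + n - 1)"
    using assms by (auto simp: poly_sum poly_monom of_nat_nat)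
  with assms show ?thesis
    by (subst b.simps) (auto simp: poly_monom)
qed

text \<open>Clearing denominators turns the induction step into a polynomial identity between multiples
  of a single factorial.\<close>

lemma poly_b_1_fact:
  "poly (b (int m) (int n)) 1 * (fact m * fact n * 2 ^ m) = fact (2 * m + n)"
proof (induction m arbitrary: n)
  case 0
  show ?case
  proof (induction n)
    case 0
    show ?case by (simp add: b_0_0)
  next
    case (Suc n)
    have "poly (b 0 (int (Suc n))) 1 = poly (b 0 (int n)) 1"
      using poly_b_1_rec[of 0 "int (Suc n)"] by (simp add: b_neg_left)
    with Suc show ?case by simp
  qed
next
  case (Suc m)
  note left = Suc.IH
  show ?case
  proof (induction n)
    case 0
    have "poly (b (int (Suc m)) 0) 1 = (2 * real m + 1) * poly (b (int m) 0) 1"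
      using poly_b_1_rec[of "int (Suc m)" 0] by (simp add: b_neg_right)
    then have "poly (b (int (Suc m)) (int 0)) 1 * (fact (Suc m) * fact 0 * 2 ^ Suc m)
        = (2 * real m + 1) * (2 * (real m + 1))
            * (poly (b (int m) (int 0)) 1 * (fact m * fact 0 * 2 ^ m))"
      by (simp add: algebra_simps)
    also have "\<dots> = (2 * real m + 1) * (2 * (real m + 1)) * fact (2 * m)"
      by (subst left) simp
    also have "\<dots> = fact (2 * Suc m + 0)"
      by (simp add: algebra_simps)
    finally show ?case .
  next
    case (Suc n)
    define N where "N = 2 * m + n + 2"
    have "poly (b (int (Suc m)) (int (Suc n))) 1
        = real N * poly (b (int m) (int (Suc n))) 1 + poly (b (int (Suc m)) (int n)) 1"
      using poly_b_1_rec[of "int (Suc m)" "int (Suc n)"] by (simp add: N_def algebra_simps)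
    then have "poly (b (int (Suc m)) (int (Suc n))) 1 * (fact (Suc m) * fact (Suc n) * 2 ^ Suc m)
        = 2 * (real m + 1) * real N
            * (poly (b (int m) (int (Suc n))) 1 * (fact m * fact (Suc n) * 2 ^ m))
          + (real n + 1)
            * (poly (b (int (Suc m)) (int n)) 1 * (fact (Suc m) * fact n * 2 ^ Suc m))"
      by (simp add: algebra_simps)
    also have "\<dots> = 2 * (real m + 1) * (real N * fact (2 * m + Suc n))
          + (real n + 1) * fact (2 * Suc m + n)"
      unfolding left Suc by (simp only: mult.assoc)
    also have "real N * fact (2 * m + Suc n) = fact N"
      by (simp add: N_def)
    also have "2 * (real m + 1) * fact N + (real n + 1) * fact (2 * Suc m + n) = fact (Suc N)"
      by (simp add: N_def algebra_simps)
    also have "Suc N = 2 * Suc m + Suc n"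
      by (simp add: N_def)
    finally show ?case .
  qed
qed

lemma poly_b_1:
  "poly (b (int m) (int n)) 1 = fact (2 * m + n) / (fact m * fact n * 2 ^ m)"
  using poly_b_1_fact[of m n] by (simp add: eq_divide_eq)

lemma coeff_bessel_poly:
  assumes "k \<le> N"
  shows "coeff (bessel_poly N) k = fact (N + k) / (fact (N - k) * fact k * 2 ^ k)"
proof -
  have pow: "[:0, 1 / 2:] ^ j = monom ((1 / 2) ^ j) j" for j :: nat
    by (metis monom_power monom_0 monom_Suc mult_1 One_nat_def)
  have "coeff (bessel_poly N) k
      = (\<Sum>j = 0..N. if j = k then fact (N + j) / (fact (N - j) * fact j) * (1 / 2) ^ j else 0)"
    unfolding bessel_poly_def by (simp add: coeff_sum pow if_distrib cong: if_cong)
  also have "\<dots> = fact (N + k) / (fact (N - k) * fact k) * (1 / 2) ^ k"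
    using assms by simp
  finally show ?thesis
    by (simp add: power_one_over)
qed

theorem mainTheorem4:
  fixes m n :: int
  assumes "m \<ge> 0" and "n \<ge> 0"
  shows "((\<lambda>q. poly (b m n) q) \<longlongrightarrow>
            fact (nat (2 * m + n)) / (fact (nat m) * fact (nat n) * 2 ^ nat m)) (at 1) \<and>
         ((\<lambda>q. poly (b m n) q) \<longlongrightarrow> coeff (bessel_poly (nat (m + n))) (nat m)) (at 1)"
proof -
  obtain i j where ij: "m = int i" "n = int j"
    using assms nonneg_int_cases by metis
  have lim: "((\<lambda>q. poly (b m n) q) \<longlongrightarrow> poly (b m n) 1) (at 1)"
    by (intro tendsto_poly tendsto_ident_at)
  have nats: "nat (2 * m + n) = 2 * i + j" "nat (m + n) = i + j" "nat m = i" "nat n = j"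
    using ij by auto
  have closed: "poly (b m n) 1 = fact (2 * i + j) / (fact i * fact j * 2 ^ i)"
    unfolding ij by (rule poly_b_1)
  have "coeff (bessel_poly (i + j)) i = fact (2 * i + j) / (fact i * fact j * 2 ^ i)"
    using coeff_bessel_poly[of i "i + j"] by (simp add: mult_2_right ac_simps)
  with lim closed show ?thesis
    by (simp only: nats)
qed

end
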